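(* Let $G_{13,24}$ be the simple graph with vertex set $\{0,1,\dots,12\}$ and the following 24 edges: $(0,2)$, $(0,3)$, $(0,4)$, $(0,5)$, $(1,5)$, $(1,9)$, $(1,10)$, $(1,12)$, $(2,5)$, $(2,6)$, $(2,7)$, $(3,9)$, $(3,11)$, $(3,12)$, $(4,6)$, $(4,8)$, $(4,10)$, $(5,8)$, $(6,8)$, $(6,9)$, $(7,10)$, $(7,11)$, $(7,12)$, $(8,11)$. Then the Colin de Verdière invariant of this graph satisfies $\mu(G_{13,24}) = 6$.
   Context: For a simple graph $G$ on vertex set $V=\{1,\dots,n\}$, the Colin de Verdière invariant $\mu(G)$ is the largest corank of a real symmetric $n\times n$ matrix $M=(M_{ij})$ such that: (1) for $i\neq j$, $M_{ij}<0$ if $i$ and $j$ are adjacent and $M_{ij}=0$ if they are not (diagonal entries are arbitrary); (2) $M$ has exactly one negative eigenvalue, of multiplicity 1; (3) (Strong Arnold Property) there is no nonzero real symmetric $n\times n$ matrix $X$ with $MX=0$ and with $X_{ij}=0$ whenever $i=j$ or $M_{ij}\neq 0$. *)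

theory Defs
  imports "Jordan_Normal_Form.Matrix_Kernel" "Jordan_Normal_Form.Char_Poly"
begin

text \<open>A graph is given by a number \<open>n\<close>, its vertices being \<open>0, \<dots>, n - 1\<close> (matching the index
  range of \<open>n \<times> n\<close> matrices), and a set of edges, each a two-element set of vertices.\<close>

definition simple_graph :: "nat \<Rightarrow> nat set set \<Rightarrow> bool" where
  "simple_graph n E \<longleftrightarrow> (\<forall>e\<in>E. e \<subseteq> {0..<n} \<and> card e = 2)"

definition symmetric_matrix :: "nat \<Rightarrow> real mat \<Rightarrow> bool" where
  "symmetric_matrix n M \<longleftrightarrow> M \<in> carrier_mat n n \<and> transpose_mat M = M"

definition sign_pattern :: "nat \<Rightarrow> nat set set \<Rightarrow> real mat \<Rightarrow> bool" where
  "sign_pattern n E M \<longleftrightarrow>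
     (\<forall>i<n. \<forall>j<n. i \<noteq> j \<longrightarrow>
        (if {i, j} \<in> E then M $$ (i, j) < 0 else M $$ (i, j) = 0))"

text \<open>The multiplicity is the algebraic one; it agrees with the geometric one because only
  symmetric matrices are considered.\<close>

definition one_negative_eigenvalue :: "real mat \<Rightarrow> bool" where
  "one_negative_eigenvalue M \<longleftrightarrow>
     (\<exists>l. {k. eigenvalue M k \<and> k < 0} = {l} \<and> order l (char_poly M) = 1)"

definition strong_Arnold_property :: "nat \<Rightarrow> real mat \<Rightarrow> bool" where
  "strong_Arnold_property n M \<longleftrightarrow>
     \<not> (\<exists>X. symmetric_matrix n X \<and> X \<noteq> 0\<^sub>m n n \<and> M * X = 0\<^sub>m n n \<and>
          (\<forall>i<n. \<forall>j<n. i = j \<or> M $$ (i, j) \<noteq> 0 \<longrightarrow> X $$ (i, j) = 0))"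

definition CdV_matrices :: "nat \<Rightarrow> nat set set \<Rightarrow> real mat set" where
  "CdV_matrices n E = {M. symmetric_matrix n M \<and> sign_pattern n E M \<and>
     one_negative_eigenvalue M \<and> strong_Arnold_property n M}"

text \<open>The corank of a square matrix is the dimension of its kernel. The set below is finite
  (see \<open>finite_CdV_coranks\<close>); it is also nonempty for every graph with \<open>n > 0\<close>,
  so that \<^const>\<open>Max\<close> is meaningful.\<close>

definition colin_de_verdiere :: "nat \<Rightarrow> nat set set \<Rightarrow> nat" where
  "colin_de_verdiere n E = Max (kernel_dim ` CdV_matrices n E)"

lemma finite_CdV_coranks: "finite (kernel_dim ` CdV_matrices n E)"
proof (rule finite_subset)
  show "kernel_dim ` CdV_matrices n E \<subseteq> {..n}"
    by (auto simp: CdV_matrices_def symmetric_matrix_def kernel_dim_code)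
qed simp

definition G_13_24 :: "nat set set" where
  "G_13_24 =
    {{0,2}, {0,3}, {0,4}, {0,5}, {1,5}, {1,9}, {1,10}, {1,12},
     {2,5}, {2,6}, {2,7}, {3,9}, {3,11}, {3,12}, {4,6}, {4,8},
     {4,10}, {5,8}, {6,8}, {6,9}, {7,10}, {7,11}, {7,12}, {8,11}}"

lemma simple_graph_G_13_24: "simple_graph 13 G_13_24"
  by (simp add: simple_graph_def G_13_24_def)

lemma card_G_13_24: "card G_13_24 = 24"
  by (simp add: G_13_24_def doubleton_eq_iff)

end

(* Upper bound: {0,1,2,3,4,6} is a zero forcing set, so a kernel vector of any matrix supported on
   the graph vanishes as soon as its six coordinates there do.

   Lower bound: the pairs of vertices among 1,...,8 that are neither adjacent nor have a common
   neighbour in the independent set {0,9,10,11,12} form the triangles {1,2,8} and {5,6,7}. After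
   eliminating that independent set (with positive diagonal entries), a matrix of corank 6 with one negative eigenvalue leaves a
   form of signature (1,1), in which 1,2,8 must lie on one isotropic line and 5,6,7 on the other.
   So the form is -AB with A, B linear, A free of the variables 5,6,7 and B of 1,2,8. This leaves
   a three-parameter family up to diagonal scaling; the member chosen has integer entries and is
   scaled so that -8 is an eigenvalue with an integer eigenvector. *)

theory Submission
  imports Defs "Jordan_Normal_Form.DL_Rank"
begin

subsection \<open>Bounding the dimension of a kernel by coordinates\<close>

text \<open>Given more than \<open>card J\<close> independent kernel vectors, requiring a
  combination of them to vanish on \<open>J\<close> is a homogeneous system with more unknowns than
  equations. A nontrivial solution yields a combination that is zero by \<open>inj\<close>, against
  independence.\<close>

lemma kernel_dim_le_card:
  fixes A :: "'a :: field mat"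
  assumes A: "A \<in> carrier_mat nr nc" and J: "finite J" "J \<subseteq> {..<nc}"
    and inj: "\<And>v. v \<in> mat_kernel A \<Longrightarrow> (\<And>j. j \<in> J \<Longrightarrow> v $ j = 0) \<Longrightarrow> v = 0\<^sub>v nc"
  shows "kernel_dim A \<le> card J"
proof (rule ccontr)
  interpret kernel nr nc A by unfold_locales (rule A)
  assume "\<not> kernel_dim A \<le> card J"
  from kernel_basis_exists[OF A] obtain S where S: "finite S" "Ker.basis S" by blast
  have SK: "S \<subseteq> mat_kernel A" and li: "NC.lin_indpt S"
    using S lindep_same unfolding Ker.basis_def by auto
  obtain ss where ss: "set ss = S" "distinct ss" using S(1) finite_distinct_list by blast
  define d where "d = length ss"
  have d: "card J < d"
    using \<open>\<not> kernel_dim A \<le> card J\<close> Ker.dim_basis[OF S] ss distinct_card[of ss] by (simp add: d_def)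
  obtain js where js: "set js = J" "distinct js" using J(1) finite_distinct_list by blast
  have len: "length js = card J" using js distinct_card by metis
  have ss_carrier: "set ss \<subseteq> carrier_vec nc" using ss SK mat_kernel[OF A] by auto
  define B where "B = mat_of_cols nc ss"
  have B: "B \<in> carrier_mat nc d" by (simp add: B_def d_def)
  have colsB: "cols B = ss" using ss_carrier by (simp add: B_def)
  \<comment> \<open>The rows of \<open>B\<close> indexed by \<open>J\<close>, padded with zero rows
    to a square matrix. Row \<open>card J\<close> exists because \<open>card J < d\<close> and is
    zero; expanding along it gives determinant 0.\<close>
  define C where "C = mat d d (\<lambda>(i, j). if i < card J then B $$ (js ! i, j) else 0)"
  have C: "C \<in> carrier_mat d d" by (simp add: C_def)
  have "det C = 0"
    unfolding laplace_expansion_row[OF C d] using d by (auto simp: C_def intro!: sum.neutral)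
  then obtain w where w: "w \<in> carrier_vec d" "w \<noteq> 0\<^sub>v d" "C *\<^sub>v w = 0\<^sub>v d"
    using det_0_iff_vec_prod_zero_field[OF C] by blast
  have "B *\<^sub>v w = 0\<^sub>v nc"
  proof (rule inj)
    show "B *\<^sub>v w \<in> mat_kernel A"
    proof -
      have "B *\<^sub>v w = NC.lincomb (\<lambda>a. w $ find_first a (cols B)) S"
        using NC.lincomb_eq_mat_mult[OF B w(1)] colsB ss by simp
      also have "\<dots> = lincomb (\<lambda>a. w $ find_first a (cols B)) S"
        using lincomb_same[OF SK] by simp
      also have "\<dots> \<in> mat_kernel A" using SK by (intro Ker.lincomb_closed) auto
      finally show ?thesis .
    qed
    fix j assume "j \<in> J"
    then obtain i where i: "i < card J" "j = js ! i" using js len by (metis in_set_conv_nth)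
    have "j < nc" using J \<open>j \<in> J\<close> by auto
    have "row B j = row C i"
      using B C i d \<open>j < nc\<close> by (intro eq_vecI) (auto simp: C_def)
    then have "(B *\<^sub>v w) $ j = (C *\<^sub>v w) $ i"
      using B C i d \<open>j < nc\<close> by simp
    then show "(B *\<^sub>v w) $ j = 0" using w(3) i(1) d by simp
  qed
  then have "NC.lin_dep S" using NC.lin_depI[OF B w(1,2)] colsB ss by simp
  with li show False by simp
qed

text \<open>Restricted to the coordinates in \<open>J\<close>, the vectors \<open>f j\<close> are
  unit vectors, so coordinate \<open>i\<close> of a vanishing combination is the coefficient of
  \<open>f i\<close>.\<close>

lemma card_le_kernel_dim:
  fixes A :: "'a :: field mat"
  assumes A: "A \<in> carrier_mat nr nc" and J: "finite J" "J \<subseteq> {..<nc}"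
    and f: "\<And>j. j \<in> J \<Longrightarrow> f j \<in> mat_kernel A"
    and delta: "\<And>i j. i \<in> J \<Longrightarrow> j \<in> J \<Longrightarrow> f j $ i = (if i = j then 1 else 0)"
  shows "card J \<le> kernel_dim A"
proof -
  interpret kernel nr nc A by unfold_locales (rule A)
  have inj: "inj_on f J"
    by (rule inj_onI) (metis delta zero_neq_one)
  have sub: "f ` J \<subseteq> mat_kernel A" using f by auto
  have "Ker.lin_indpt (f ` J)"
  proof (rule Ker.finite_lin_indpt2)
    show "finite (f ` J)" using J by simp
    show "f ` J \<subseteq> mat_kernel A" by (rule sub)
    fix a :: "'a vec \<Rightarrow> 'a" assume "lincomb a (f ` J) = 0\<^sub>v nc"
    then have z: "NC.lincomb a (f ` J) = 0\<^sub>v nc" using lincomb_same[OF sub] by simp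
    show "\<forall>v\<in>f ` J. a v = 0"
    proof clarify
      fix i assume i: "i \<in> J"
      have "0 = NC.lincomb a (f ` J) $ i" using z i J by auto
      also have "\<dots> = (\<Sum>x\<in>f ` J. a x * x $ i)"
        using i J sub mat_kernel[OF A] by (intro NC.lincomb_index) auto
      also have "\<dots> = (\<Sum>j\<in>J. a (f j) * f j $ i)"
        using inj by (simp add: sum.reindex)
      also have "\<dots> = (\<Sum>j\<in>J. if i = j then a (f j) else 0)"
        using i by (intro sum.cong) (auto simp: delta)
      also have "\<dots> = a (f i)" using i J by simp
      finally show "a (f i) = 0" by simp
    qed
  qed
  moreover have "Ker.fin_dim"
    using kernel_basis_exists[OF A] unfolding Ker.fin_dim_def Ker.basis_def by blast
  ultimately have "card (f ` J) \<le> dim" using Ker.li_le_dim sub by blast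
  then show ?thesis using card_image[OF inj] by simp
qed

subsection \<open>Multiplicity of eigenvalues of symmetric matrices\<close>

lemma scalar_prod_self_pos:
  fixes u :: "real vec"
  assumes "u \<in> carrier_vec n" and "u \<noteq> 0\<^sub>v n"
  shows "0 < u \<bullet> u"
proof -
  obtain i where "i < n" "u $ i \<noteq> 0" using assms by (metis carrier_vecD eq_vecI index_zero_vec)
  then have "0 < u $ i * u $ i" by (auto simp: zero_less_mult_iff neq_iff)
  also have "\<dots> \<le> u \<bullet> u"
    using assms \<open>i < n\<close> by (auto simp: scalar_prod_def intro!: member_le_sum)
  finally show ?thesis .
qed

text \<open>Replacing column 0 of \<open>x - A\<close> by \<open>(x - A) v = (x - l) v\<close> multiplies the determinant by
  \<open>v $ 0\<close> and splits off the factor \<open>x - l\<close>. A second such factor makes the cofactor singular at \<open>l\<close>,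
  which yields an eigenvector of \<open>l\<close> outside the span of \<open>v\<close>.\<close>

lemma order_char_poly_eq_1:
  fixes A :: "real mat"
  assumes A: "A \<in> carrier_mat n n" and sym: "transpose_mat A = A"
    and v: "v \<in> carrier_vec n" "0 < n" "v $ 0 \<noteq> 0" and Av: "A *\<^sub>v v = l \<cdot>\<^sub>v v"
    and simple: "\<And>u. u \<in> carrier_vec n \<Longrightarrow> A *\<^sub>v u = l \<cdot>\<^sub>v u \<Longrightarrow> \<exists>c. u = c \<cdot>\<^sub>v v"
  shows "order l (char_poly A) = 1"
proof (rule antisym)
  have "v \<noteq> 0\<^sub>v n" using v by auto
  then have "eigenvalue A l" using A v Av unfolding eigenvalue_def eigenvector_def by auto
  moreover have nz: "char_poly A \<noteq> 0" using degree_monic_char_poly[OF A] by auto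
  ultimately show "1 \<le> order l (char_poly A)"
    using eigenvalue_root_char_poly[OF A] order_root[of "char_poly A" l] by auto
  show "order l (char_poly A) \<le> 1"
  proof (rule ccontr)
    assume "\<not> order l (char_poly A) \<le> 1"
    then have "[:-l, 1:] ^ 2 dvd char_poly A"
      by (intro order_divides[THEN iffD2]) auto
    then obtain q where q: "char_poly A = [:-l, 1:] * ([:-l, 1:] * q)"
      unfolding dvd_def power2_eq_square mult.assoc by blast
    define C where "C = char_poly_matrix A"
    define P where "P = mat n n (\<lambda>(i, j). if j = 0 then [:v $ i:] else if i = j then 1 else 0)"
    define B where "B = mat n n (\<lambda>(i, j). if j = 0 then [:v $ i:] else C $$ (i, j))"
    define D where "D = mat n n (\<lambda>(i, j). if i = j then if j = 0 then [:-l, 1:] else 1 else (0 :: real poly))"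
    have carr: "C \<in> carrier_mat n n" "P \<in> carrier_mat n n" "B \<in> carrier_mat n n" "D \<in> carrier_mat n n"
      using A by (auto simp: C_def P_def B_def D_def)
    have Cij: "C $$ (i, j) = (if i = j then [:- A $$ (i, j), 1:] else [:- A $$ (i, j):])"
      if "i < n" "j < n" for i j
      using that A by (simp add: C_def char_poly_matrix_def)
    have const: "(\<Sum>k<m. [:g k:]) = [:\<Sum>k<m. g k:]" for m and g :: "nat \<Rightarrow> real"
      by (induction m) auto
    have "C * P = B * D"
    proof (rule eq_matI)
      fix i j assume "i < dim_row (B * D)" "j < dim_col (B * D)"
      then have ij: "i < n" "j < n" using carr by auto
      have r: "(B * D) $$ (i, j) = B $$ (i, j) * D $$ (j, j)"
      proof -
        have "(B * D) $$ (i, j) = (\<Sum>k<n. B $$ (i, k) * D $$ (k, j))"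
          using carr ij by (simp add: scalar_prod_def atLeast0LessThan)
        also have "\<dots> = (\<Sum>k<n. if k = j then B $$ (i, j) * D $$ (j, j) else 0)"
          using ij by (intro sum.cong) (auto simp: D_def)
        finally show ?thesis using ij by simp
      qed
      show "(C * P) $$ (i, j) = (B * D) $$ (i, j)"
      proof (cases "j = 0")
        case True
        have "(C * P) $$ (i, j) = (\<Sum>k<n. C $$ (i, k) * [:v $ k:])"
          using carr ij True by (simp add: scalar_prod_def atLeast0LessThan P_def)
        also have "\<dots> = (\<Sum>k<n. (if i = k then [:0, v $ k:] else 0) - [:A $$ (i, k) * v $ k:])"
          by (intro sum.cong) (auto simp: Cij ij mult.commute)
        also have "\<dots> = [:0, v $ i:] - [:\<Sum>k<n. A $$ (i, k) * v $ k:]"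
          using ij by (simp add: sum_subtractf const)
        also have "(\<Sum>k<n. A $$ (i, k) * v $ k) = (A *\<^sub>v v) $ i"
          using A v ij by (simp add: scalar_prod_def atLeast0LessThan)
        also have "\<dots> = l * v $ i" using Av ij v by simp
        finally show ?thesis unfolding r using True ij by (simp add: B_def D_def)
      next
        case False
        have "(C * P) $$ (i, j) = (\<Sum>k<n. C $$ (i, k) * P $$ (k, j))"
          using carr ij by (simp add: scalar_prod_def atLeast0LessThan)
        also have "\<dots> = (\<Sum>k<n. if k = j then C $$ (i, j) else 0)"
          using ij False by (intro sum.cong) (auto simp: P_def)
        also have "\<dots> = C $$ (i, j)" using ij by simp
        finally have "(C * P) $$ (i, j) = C $$ (i, j)" .
        then show ?thesis unfolding r using False ij by (simp add: B_def D_def)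
      qed
    qed (use carr in auto)
    then have "det C * det P = det B * det D"
      using det_mult[OF carr(1,2)] det_mult[OF carr(3,4)] by simp
    moreover have "det P = [:v $ 0:]"
    proof -
      have "det P = prod_list (diag_mat P)"
        by (rule det_lower_triangular[OF _ carr(2)]) (auto simp: P_def)
      also have "\<dots> = (\<Prod>i<n. P $$ (i, i))"
        using carr by (simp add: diag_mat_def prod.list_conv_set_nth atLeast0LessThan)
      also have "\<dots> = (\<Prod>i<n. if i = 0 then [:v $ 0:] else 1)"
        by (intro prod.cong) (auto simp: P_def)
      finally show ?thesis using v by simp
    qed
    moreover have "det D = [:-l, 1:]"
    proof -
      have "det D = prod_list (diag_mat D)"
        by (rule det_lower_triangular[OF _ carr(4)]) (auto simp: D_def)
      also have "\<dots> = (\<Prod>i<n. D $$ (i, i))"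
        using carr by (simp add: diag_mat_def prod.list_conv_set_nth atLeast0LessThan)
      also have "\<dots> = (\<Prod>i<n. if i = 0 then [:-l, 1:] else 1)"
        by (intro prod.cong) (auto simp: D_def)
      finally show ?thesis using v by simp
    qed
    ultimately have "[:-l, 1:] * ([:-l, 1:] * q * [:v $ 0:]) = [:-l, 1:] * det B"
      using q by (simp add: char_poly_def C_def mult_ac)
    then have "[:-l, 1:] * q * [:v $ 0:] = det B"
      by (subst (asm) mult_cancel_left) simp
    then have root: "poly (det B) l = 0" by (auto dest: arg_cong[of _ _ "\<lambda>p. poly p l"])
    \<comment> \<open>\<open>B0\<close> is \<open>B\<close> evaluated at \<open>l\<close>. Below,
      \<open>u\<close> is its kernel vector \<open>w\<close> with coordinate 0 erased, and
      \<open>B0 w = 0\<close> reads \<open>(A - l) u = (w $ 0) v\<close>.\<close>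
    define B0 where "B0 = mat n n (\<lambda>(i, j). if j = 0 then v $ i else (if i = j then l else 0) - A $$ (i, j))"
    have B0: "B0 \<in> carrier_mat n n" by (simp add: B0_def)
    have "poly (det B) l = det B0"
      by (rule poly_det_cong[OF B0 carr(3)]) (auto simp: B_def B0_def Cij)
    with root obtain w where w: "w \<in> carrier_vec n" "w \<noteq> 0\<^sub>v n" "B0 *\<^sub>v w = 0\<^sub>v n"
      using det_0_iff_vec_prod_zero_field[OF B0] by auto
    define u where "u = vec n (\<lambda>i. if i = 0 then 0 else w $ i)"
    have u: "u \<in> carrier_vec n" by (simp add: u_def)
    have Au: "A *\<^sub>v u = l \<cdot>\<^sub>v u + w $ 0 \<cdot>\<^sub>v v"
    proof (rule eq_vecI)
      fix i assume "i < dim_vec (l \<cdot>\<^sub>v u + w $ 0 \<cdot>\<^sub>v v)"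
      then have i: "i < n" using v by simp
      have "0 = (\<Sum>k<n. B0 $$ (i, k) * w $ k)"
        using arg_cong[OF w(3), of "\<lambda>x. x $ i"] B0 w(1) i by (simp add: scalar_prod_def atLeast0LessThan)
      also have "\<dots> = (\<Sum>k<n. (if k = 0 then v $ i * w $ 0 else 0) + (if k = i then l * u $ i else 0) - A $$ (i, k) * u $ k)"
        using i by (intro sum.cong) (auto simp: B0_def u_def algebra_simps)
      also have "\<dots> = v $ i * w $ 0 + l * u $ i - (A *\<^sub>v u) $ i"
        using A u i v by (simp add: sum_subtractf sum.distrib scalar_prod_def atLeast0LessThan)
      finally show "(A *\<^sub>v u) $ i = (l \<cdot>\<^sub>v u + w $ 0 \<cdot>\<^sub>v v) $ i" using i u v by (simp add: mult.commute)
    qed (use A u v in auto)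
    \<comment> \<open>A symmetric matrix has no proper generalised eigenvectors: pairing the
      equation \<open>Au\<close> with \<open>v\<close> leaves only \<open>w $ 0\<close> times the
      squared length of \<open>v\<close>.\<close>
    have "l * (v \<bullet> u) = v \<bullet> (A *\<^sub>v u)"
      using transpose_vec_mult_scalar[OF A u v(1)] sym Av u v by simp
    also have "\<dots> = l * (v \<bullet> u) + w $ 0 * (v \<bullet> v)"
      unfolding Au using u v by (simp add: scalar_prod_add_distrib[of _ n])
    finally have "w $ 0 * (v \<bullet> v) = 0" by simp
    moreover have "0 < v \<bullet> v" using scalar_prod_self_pos v(1) \<open>v \<noteq> 0\<^sub>v n\<close> by blast
    ultimately have w0: "w $ 0 = 0" by simp
    then have "u = w" using w(1) by (auto simp: u_def)
    moreover have "A *\<^sub>v u = l \<cdot>\<^sub>v u" unfolding Au w0 using u v by (intro eq_vecI) auto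
    \<comment> \<open>Coordinate 0 vanishes for \<open>w\<close> but not for \<open>v\<close>, so
      \<open>c = 0\<close> and \<open>w = 0\<close>, a contradiction.\<close>
    ultimately obtain c where "w = c \<cdot>\<^sub>v v" using simple[OF u] by blast
    with w0 v w show False by auto
  qed
qed

subsection \<open>The upper bound\<close>

lemma less_13_cases: "i < 13 \<longleftrightarrow> i \<in> {0, 1, 2, 3, 4, 5, 6, 7, 8, 9, 10, 11, 12 :: nat}"
  by (simp, arith)

text \<open>One zero forcing step: in row \<open>i\<close> of \<open>M v = 0\<close> only the term
  of \<open>j\<close> survives. The arbitrary diagonal entry does no harm because
  \<open>v $ i = 0\<close>.\<close>

lemma kernel_coord_forced:
  assumes M: "M \<in> carrier_mat n n" and pat: "sign_pattern n E M" and v: "v \<in> mat_kernel M"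
    and ij: "i < n" "j < n" "i \<noteq> j" "{i, j} \<in> E" and "v $ i = 0"
    and nbrs: "\<And>k. k < n \<Longrightarrow> {i, k} \<in> E \<Longrightarrow> k \<noteq> j \<Longrightarrow> v $ k = 0"
  shows "v $ j = 0"
proof -
  have "0 = (\<Sum>k<n. M $$ (i, k) * v $ k)"
    using arg_cong[OF mat_kernelD(2)[OF M v], of "\<lambda>x. x $ i"] mat_kernelD(1)[OF M v] M ij
    by (simp add: scalar_prod_def atLeast0LessThan)
  also have "\<dots> = (\<Sum>k<n. if k = j then M $$ (i, j) * v $ j else 0)"
  proof (intro sum.cong refl)
    fix k assume "k \<in> {..<n}"
    then show "M $$ (i, k) * v $ k = (if k = j then M $$ (i, j) * v $ j else 0)"
      using pat nbrs[of k] \<open>v $ i = 0\<close> ij unfolding sign_pattern_def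
      by (cases "i = k"; cases "{i, k} \<in> E") auto
  qed
  finally have "M $$ (i, j) * v $ j = 0" using ij by simp
  moreover have "M $$ (i, j) < 0" using pat ij unfolding sign_pattern_def by auto
  ultimately show ?thesis by simp
qed

lemma kernel_dim_le_6:
  assumes "M \<in> carrier_mat 13 13" and "sign_pattern 13 G_13_24 M"
  shows "kernel_dim M \<le> 6"
proof -
  \<comment> \<open>the index set is a minimum zero forcing set of the graph\<close>
  have "kernel_dim M \<le> card {0, 1, 2, 3, 4, 6 :: nat}"
  proof (rule kernel_dim_le_card[OF assms(1)])
    fix v assume v: "v \<in> mat_kernel M" and J: "\<And>j. j \<in> {0, 1, 2, 3, 4, 6 :: nat} \<Longrightarrow> v $ j = 0"
    note forced = kernel_coord_forced[OF assms v]
    have z: "v $ 0 = 0" "v $ 1 = 0" "v $ 2 = 0" "v $ 3 = 0" "v $ 4 = 0" "v $ 6 = 0"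
      using J by auto
    \<comment> \<open>The forcing order is 0 -> 5, 2 -> 7, 5 -> 8, 6 -> 9, 4 -> 10, 8 -> 11, 1 ->
      12; each vertex on the left has by then a single neighbour not known to vanish.\<close>
    have "v $ 5 = 0"
      by (rule forced[of 0]) (use z in \<open>auto simp: G_13_24_def doubleton_eq_iff\<close>)
    note z = z this
    have "v $ 7 = 0"
      by (rule forced[of 2]) (use z in \<open>auto simp: G_13_24_def doubleton_eq_iff\<close>)
    note z = z this
    have "v $ 8 = 0"
      by (rule forced[of 5]) (use z in \<open>auto simp: G_13_24_def doubleton_eq_iff\<close>)
    note z = z this
    have "v $ 9 = 0"
      by (rule forced[of 6]) (use z in \<open>auto simp: G_13_24_def doubleton_eq_iff\<close>)
    note z = z this
    have "v $ 10 = 0"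
      by (rule forced[of 4]) (use z in \<open>auto simp: G_13_24_def doubleton_eq_iff\<close>)
    note z = z this
    have "v $ 11 = 0"
      by (rule forced[of 8]) (use z in \<open>auto simp: G_13_24_def doubleton_eq_iff\<close>)
    note z = z this
    have "v $ 12 = 0"
      by (rule forced[of 1]) (use z in \<open>auto simp: G_13_24_def doubleton_eq_iff\<close>)
    note z = z this
    have "v $ i = 0" if "i < 13" for i
    proof -
      show ?thesis using that z unfolding less_13_cases by auto
    qed
    then show "v = 0\<^sub>v 13" using mat_kernelD(1)[OF assms(1) v] by auto
  qed auto
  then show ?thesis by simp
qed

subsection \<open>A matrix of corank 6\<close>

text \<open>The matrix of the quadratic form consisting of five squares, one for each of the
  vertices 0, 9, 10, 11, 12, minus \<open>4 * A * B\<close>, where A = v1 + 2 v2 + v3 + v4 + v8 and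
  B = v3 + v4 + 2 v5 + v6 + v7.\<close>

definition N_rows :: "real list list" where
  "N_rows =
    [[4, 0, -4, -4, -4, -4, 0, 0, 0, 0, 0, 0, 0],
     [0, 3, 0, 0, 0, -4, 0, 0, 0, -1, -1, 0, -2],
     [-4, 0, 4, 0, 0, -4, -4, -4, 0, 0, 0, 0, 0],
     [-4, 0, 0, 3, 0, 0, 0, 0, 0, -1, 0, -1, -2],
     [-4, 0, 0, 0, 4, 0, -2, 0, -2, 0, -2, 0, 0],
     [-4, -4, -4, 0, 0, 4, 0, 0, -4, 0, 0, 0, 0],
     [0, 0, -4, 0, -2, 0, 4, 0, -2, -2, 0, 0, 0],
     [0, 0, -4, 0, 0, 0, 0, 3, 0, 0, -1, -1, -2],
     [0, 0, 0, 0, -2, -4, -2, 0, 4, 0, 0, -2, 0],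
     [0, -1, 0, -1, 0, 0, -2, 0, 0, 1, 0, 0, 0],
     [0, -1, 0, 0, -2, 0, 0, -1, 0, 0, 1, 0, 0],
     [0, 0, 0, -1, 0, 0, 0, -1, -2, 0, 0, 1, 0],
     [0, -2, 0, -2, 0, 0, 0, -2, 0, 0, 0, 0, 4]]"

definition N :: "real mat" where
  "N = mat 13 13 (\<lambda>(i, j). N_rows ! i ! j)"

lemma N_carrier: "N \<in> carrier_mat 13 13"
  by (simp add: N_def)

lemma N_index: "i < 13 \<Longrightarrow> j < 13 \<Longrightarrow> N $$ (i, j) = N_rows ! i ! j"
  by (simp add: N_def)

lemma sum_less_13:
  "(\<Sum>i<13. f i) = f 0 + f 1 + f 2 + f 3 + f 4 + f 5 + f 6 + f 7 + f 8 + f 9 + f 10 + f 11 + f (12 :: nat)"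
  by (simp add: eval_nat_numeral)

lemma N_rows_sym: "i < 13 \<Longrightarrow> j < 13 \<Longrightarrow> N_rows ! i ! j = N_rows ! j ! i"
  unfolding less_13_cases N_rows_def
  by (elim insertE emptyE; hypsubst; simp)

lemma N_sym: "transpose_mat N = N"
  using N_rows_sym by (intro eq_matI) (auto simp: N_def)

lemma N_pattern: "sign_pattern 13 G_13_24 N"
  unfolding sign_pattern_def
proof (intro allI impI)
  fix i j :: nat assume "i < 13" "j < 13" "i \<noteq> j"
  then show "if {i, j} \<in> G_13_24 then N $$ (i, j) < 0 else N $$ (i, j) = 0"
    unfolding N_index[OF \<open>i < 13\<close> \<open>j < 13\<close>] less_13_cases N_rows_def G_13_24_def
    by (elim insertE emptyE; hypsubst; simp add: doubleton_eq_iff)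
qed

lemma N_mult:
  assumes "v \<in> carrier_vec 13"
  shows
    "(N *\<^sub>v v) $ 0 = 4 * (v $ 0 - v $ 2 - v $ 3 - v $ 4 - v $ 5)"
    "(N *\<^sub>v v) $ 1 = 3 * v $ 1 - 4 * v $ 5 - v $ 9 - v $ 10 - 2 * v $ 12"
    "(N *\<^sub>v v) $ 2 = 4 * (v $ 2 - v $ 0 - v $ 5 - v $ 6 - v $ 7)"
    "(N *\<^sub>v v) $ 3 = 3 * v $ 3 - 4 * v $ 0 - v $ 9 - v $ 11 - 2 * v $ 12"
    "(N *\<^sub>v v) $ 4 = 4 * v $ 4 - 4 * v $ 0 - 2 * v $ 6 - 2 * v $ 8 - 2 * v $ 10"
    "(N *\<^sub>v v) $ 5 = 4 * (v $ 5 - v $ 0 - v $ 1 - v $ 2 - v $ 8)"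
    "(N *\<^sub>v v) $ 6 = 4 * v $ 6 - 4 * v $ 2 - 2 * v $ 4 - 2 * v $ 8 - 2 * v $ 9"
    "(N *\<^sub>v v) $ 7 = 3 * v $ 7 - 4 * v $ 2 - v $ 10 - v $ 11 - 2 * v $ 12"
    "(N *\<^sub>v v) $ 8 = 4 * v $ 8 - 2 * v $ 4 - 4 * v $ 5 - 2 * v $ 6 - 2 * v $ 11"
    "(N *\<^sub>v v) $ 9 = v $ 9 - v $ 1 - v $ 3 - 2 * v $ 6"
    "(N *\<^sub>v v) $ 10 = v $ 10 - v $ 1 - 2 * v $ 4 - v $ 7"
    "(N *\<^sub>v v) $ 11 = v $ 11 - v $ 3 - v $ 7 - 2 * v $ 8"
    "(N *\<^sub>v v) $ 12 = 4 * v $ 12 - 2 * v $ 1 - 2 * v $ 3 - 2 * v $ 7"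
proof -
  have eq: "(N *\<^sub>v v) $ i = (\<Sum>k<13. N_rows ! i ! k * v $ k)" if "i < 13" for i
    using assms that by (simp add: scalar_prod_def atLeast0LessThan N_def)
  show
    "(N *\<^sub>v v) $ 0 = 4 * (v $ 0 - v $ 2 - v $ 3 - v $ 4 - v $ 5)"
    "(N *\<^sub>v v) $ 1 = 3 * v $ 1 - 4 * v $ 5 - v $ 9 - v $ 10 - 2 * v $ 12"
    "(N *\<^sub>v v) $ 2 = 4 * (v $ 2 - v $ 0 - v $ 5 - v $ 6 - v $ 7)"
    "(N *\<^sub>v v) $ 3 = 3 * v $ 3 - 4 * v $ 0 - v $ 9 - v $ 11 - 2 * v $ 12"
    "(N *\<^sub>v v) $ 4 = 4 * v $ 4 - 4 * v $ 0 - 2 * v $ 6 - 2 * v $ 8 - 2 * v $ 10"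
    "(N *\<^sub>v v) $ 5 = 4 * (v $ 5 - v $ 0 - v $ 1 - v $ 2 - v $ 8)"
    "(N *\<^sub>v v) $ 6 = 4 * v $ 6 - 4 * v $ 2 - 2 * v $ 4 - 2 * v $ 8 - 2 * v $ 9"
    "(N *\<^sub>v v) $ 7 = 3 * v $ 7 - 4 * v $ 2 - v $ 10 - v $ 11 - 2 * v $ 12"
    "(N *\<^sub>v v) $ 8 = 4 * v $ 8 - 2 * v $ 4 - 4 * v $ 5 - 2 * v $ 6 - 2 * v $ 11"
    "(N *\<^sub>v v) $ 9 = v $ 9 - v $ 1 - v $ 3 - 2 * v $ 6"
    "(N *\<^sub>v v) $ 10 = v $ 10 - v $ 1 - 2 * v $ 4 - v $ 7"
    "(N *\<^sub>v v) $ 11 = v $ 11 - v $ 3 - v $ 7 - 2 * v $ 8"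
    "(N *\<^sub>v v) $ 12 = 4 * v $ 12 - 2 * v $ 1 - 2 * v $ 3 - 2 * v $ 7"
    by (simp_all add: eq sum_less_13 N_rows_def del: index_mult_mat_vec)
qed

text \<open>The quadratic form is nondegenerate in seven linearly independent linear forms: the five
  that are squared, and A and B. The kernel is their common zero set, of dimension 13 - 7 =
  6.\<close>

lemma N_kernel_iff:
  assumes "v \<in> carrier_vec 13"
  shows "N *\<^sub>v v = 0\<^sub>v 13 \<longleftrightarrow>
    v $ 0 = v $ 2 + v $ 3 + v $ 4 + v $ 5 \<and>
    v $ 9 = v $ 1 + v $ 3 + 2 * v $ 6 \<and>
    v $ 10 = v $ 1 + v $ 7 + 2 * v $ 4 \<and>
    v $ 11 = v $ 3 + v $ 7 + 2 * v $ 8 \<and>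
    2 * v $ 12 = v $ 1 + v $ 3 + v $ 7 \<and>
    v $ 1 + 2 * v $ 2 + v $ 3 + v $ 4 + v $ 8 = 0 \<and>
    v $ 3 + v $ 4 + 2 * v $ 5 + v $ 6 + v $ 7 = 0" (is "?L \<longleftrightarrow> ?R")
proof
  assume L: ?L
  have "(N *\<^sub>v v) $ i = 0" if "i < 13" for i using L that by simp
  \<comment> \<open>Rows 0 and 9 to 12 give the first five equations. Substituting for
    \<open>v $ 0\<close> turns row 5 into A = 0 and row 2 into B = 0.\<close>
  from this[of 0] this[of 1] this[of 2] this[of 3] this[of 4] this[of 5] this[of 6] this[of 7]
    this[of 8] this[of 9] this[of 10] this[of 11] this[of 12]
  show ?R unfolding N_mult[OF assms] by simp
next
  assume R: ?R
  show ?L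
  proof (rule eq_vecI)
    fix i assume "i < dim_vec (0\<^sub>v 13 :: real vec)"
    then have i: "i < 13" by simp
    then have "(N *\<^sub>v v) $ i = 0"
      unfolding less_13_cases
      using R by (elim insertE emptyE) (simp_all add: N_mult[OF assms] del: index_mult_mat_vec One_nat_def)
    then show "(N *\<^sub>v v) $ i = 0\<^sub>v 13 $ i" using i by simp
  qed (use N_carrier in simp)
qed

section \<open>Signature: exactly one negative eigenvalue\<close>

text \<open>The hypothesis is A + B = 0, which turns the only indefinite term
  \<open>- 4 * A * B\<close> into \<open>4 * A ^ 2\<close>. Nonnegativity on a hyperplane leaves
  room for at most one negative eigenvalue.\<close>

lemma N_nonneg:
  assumes "v \<in> carrier_vec 13"
    and "v $ 1 + 2 * v $ 2 + 2 * v $ 3 + 2 * v $ 4 + 2 * v $ 5 + v $ 6 + v $ 7 + v $ 8 = 0"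
  shows "0 \<le> v \<bullet> (N *\<^sub>v v)"
proof -
  have "v \<bullet> (N *\<^sub>v v) = (\<Sum>i<13. v $ i * (N *\<^sub>v v) $ i)"
    using N_carrier by (simp add: scalar_prod_def atLeast0LessThan del: index_mult_mat_vec)
  also have "\<dots> =
      4 * (v $ 0 - v $ 2 - v $ 3 - v $ 4 - v $ 5) ^ 2
    + (v $ 9 - v $ 1 - v $ 3 - 2 * v $ 6) ^ 2
    + (v $ 10 - v $ 1 - v $ 7 - 2 * v $ 4) ^ 2
    + (v $ 11 - v $ 3 - v $ 7 - 2 * v $ 8) ^ 2
    + (2 * v $ 12 - v $ 1 - v $ 3 - v $ 7) ^ 2
    - 4 * (v $ 1 + 2 * v $ 2 + v $ 3 + v $ 4 + v $ 8) * (v $ 3 + v $ 4 + 2 * v $ 5 + v $ 6 + v $ 7)"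
    unfolding sum_less_13 N_mult[OF assms(1)] by (simp add: power2_eq_square algebra_simps del: One_nat_def)
  also have "0 \<le> \<dots>"
  proof -
    have "0 \<le> 4 * p ^ 2 + q ^ 2 + r ^ 2 + s ^ 2 + t ^ 2 - 4 * a * b" if "b = - a" for p q r s t a b :: real
      unfolding that using zero_le_square[of a] by simp
    then show ?thesis by this (use assms(2) in simp)
  qed
  finally show ?thesis .
qed

lemma N_one_negative: "one_negative_eigenvalue N"
proof -
  note [simp del] = index_mult_mat_vec
  \<comment> \<open>A positive vector, constant on the orbits of the rotation (0 2 5)(1 3 7)(4 6
    8)(9 11 10), which leaves \<open>N\<close> invariant.\<close>
  define z where "z = vec 13 ((!) [9, 4, 9, 4, 5, 9, 5, 4, 5, 2, 2, 2, 2 :: real])"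
  have z: "z \<in> carrier_vec 13" by (simp add: z_def)
  have z_index: "z $ 0 = 9" "z $ 1 = 4" "z $ 2 = 9" "z $ 3 = 4" "z $ 4 = 5" "z $ 5 = 9" "z $ 6 = 5"
    "z $ 7 = 4" "z $ 8 = 5" "z $ 9 = 2" "z $ 10 = 2" "z $ 11 = 2" "z $ 12 = 2"
    by (simp_all add: z_def)
  have z_nz: "z \<noteq> 0\<^sub>v 13" using z_index(1) by auto
  have Nz: "N *\<^sub>v z = (-8) \<cdot>\<^sub>v z"
  proof (rule eq_vecI)
    fix i assume "i < dim_vec ((-8) \<cdot>\<^sub>v z)"
    then have i: "i < 13" using z by simp
    then have "(N *\<^sub>v z) $ i = -8 * z $ i"
      unfolding less_13_cases
      by (elim insertE emptyE) (simp_all add: N_mult[OF z] z_index del: One_nat_def)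
    then show "(N *\<^sub>v z) $ i = ((-8) \<cdot>\<^sub>v z) $ i" using i z by simp
  qed (use N_carrier z in simp)
  define g where "g u = u $ 1 + 2 * u $ 2 + 2 * u $ 3 + 2 * u $ 4 + 2 * u $ 5 + u $ 6 + u $ 7 + u $ 8" for u :: "real vec"
  have gz: "g z = 72" by (simp add: g_def z_index del: One_nat_def)
  \<comment> \<open>\<open>g = A + B\<close> for the two linear forms of the header, so the form is nonnegative where \<open>g = 0\<close>\<close>
  have w: "0 \<le> w \<bullet> (N *\<^sub>v w)" "w \<in> carrier_vec 13" if "u \<in> carrier_vec 13" "w = 72 \<cdot>\<^sub>v u - g u \<cdot>\<^sub>v z" for u w
  proof -
    show w: "w \<in> carrier_vec 13" using that z by simp
    \<comment> \<open>As \<open>g z = 72\<close>, this is 0: \<open>w\<close> is 72 times the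
      projection of \<open>u\<close> along \<open>z\<close> onto the hyperplane
      \<open>g = 0\<close>, scaled to avoid division.\<close>
    have "g w = 72 * g u - g u * g z"
      using that z by (simp add: g_def algebra_simps)
    then show "0 \<le> w \<bullet> (N *\<^sub>v w)" using N_nonneg[OF w] gz by (simp add: g_def)
  qed
  have Nw: "N *\<^sub>v (72 \<cdot>\<^sub>v u - c \<cdot>\<^sub>v z) = (72 * k) \<cdot>\<^sub>v u + (8 * c) \<cdot>\<^sub>v z"
    if "u \<in> carrier_vec 13" "N *\<^sub>v u = k \<cdot>\<^sub>v u" for u c k
  proof -
    have "N *\<^sub>v (72 \<cdot>\<^sub>v u - c \<cdot>\<^sub>v z) = 72 \<cdot>\<^sub>v (N *\<^sub>v u) - c \<cdot>\<^sub>v (N *\<^sub>v z)"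
      using that(1) z
      by (subst mult_minus_distrib_mat_vec[OF N_carrier]) (auto simp: mult_mat_vec[OF N_carrier])
    also have "\<dots> = (72 * k) \<cdot>\<^sub>v u + (8 * c) \<cdot>\<^sub>v z"
      unfolding that(2) Nz using that(1) z by (intro eq_vecI) auto
    finally show ?thesis .
  qed
  \<comment> \<open>With \<open>u\<close> and \<open>z\<close>, also \<open>w\<close> satisfies
    \<open>N w = -8 w\<close>. Its form value is then both nonnegative and -8 times its squared
    length, so \<open>w = 0\<close>.\<close>
  have simple: "\<exists>c. u = c \<cdot>\<^sub>v z" if u: "u \<in> carrier_vec 13" "N *\<^sub>v u = (-8) \<cdot>\<^sub>v u" for u
  proof -
    define w where "w = 72 \<cdot>\<^sub>v u - g u \<cdot>\<^sub>v z"
    note w = w[OF u(1) w_def]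
    have "N *\<^sub>v w = (-8) \<cdot>\<^sub>v w"
      unfolding w_def Nw[OF u] using u z by (intro eq_vecI) auto
    then have "0 \<le> - 8 * (w \<bullet> w)" using w by simp
    then have "w = 0\<^sub>v 13" using scalar_prod_self_pos[OF w(2)] by fastforce
    have "u = (g u / 72) \<cdot>\<^sub>v z"
    proof (rule eq_vecI)
      fix i assume "i < dim_vec ((g u / 72) \<cdot>\<^sub>v z)"
      then have "72 * u $ i - g u * z $ i = 0"
        using arg_cong[OF \<open>w = 0\<^sub>v 13\<close>, of "\<lambda>x. x $ i"] u z by (simp add: w_def)
      then show "u $ i = ((g u / 72) \<cdot>\<^sub>v z) $ i"
        using \<open>i < dim_vec ((g u / 72) \<cdot>\<^sub>v z)\<close> z by simp
    qed (use u z in simp)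
    then show ?thesis by blast
  qed
  have unique: "k = -8" if "eigenvalue N k" "k < 0" for k
  proof (rule ccontr)
    assume "k \<noteq> -8"
    obtain u where u: "u \<in> carrier_vec 13" "u \<noteq> 0\<^sub>v 13" "N *\<^sub>v u = k \<cdot>\<^sub>v u"
      using \<open>eigenvalue N k\<close> N_carrier unfolding eigenvalue_def eigenvector_def by auto
    have "k * (z \<bullet> u) = z \<bullet> (N *\<^sub>v u)" using u z by simp
    also have "\<dots> = -8 * (z \<bullet> u)"
      using transpose_vec_mult_scalar[OF N_carrier u(1) z] N_sym Nz u z by simp
    finally have "(k + 8) * (z \<bullet> u) = 0" by (simp add: distrib_right)
    then have zu: "z \<bullet> u = 0" using \<open>k \<noteq> -8\<close> by simp
    then have uz: "u \<bullet> z = 0" using comm_scalar_prod[OF u(1) z] by simp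
    \<comment> \<open>Since \<open>u\<close> and \<open>z\<close> are orthogonal, the mixed terms
      drop out, and both remaining terms have the wrong sign.\<close>
    have "0 \<le> (72 \<cdot>\<^sub>v u - g u \<cdot>\<^sub>v z) \<bullet> (N *\<^sub>v (72 \<cdot>\<^sub>v u - g u \<cdot>\<^sub>v z))"
      by (rule w(1)[OF u(1) refl])
    also have "\<dots> = 72 * 72 * (k * (u \<bullet> u)) - 8 * (g u * g u * (z \<bullet> z))"
      unfolding Nw[OF u(1,3)] using u z zu uz
      by (simp add: scalar_prod_add_distrib[of _ 13] minus_scalar_prod_distrib[of _ 13] algebra_simps)
    also have "\<dots> < 0"
    proof -
      have "k * (u \<bullet> u) < 0" using scalar_prod_self_pos[OF u(1,2)] \<open>k < 0\<close> by (simp add: mult_neg_pos)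
      moreover have "0 \<le> g u * g u * (z \<bullet> z)"
        using scalar_prod_self_pos[OF z z_nz] by (intro mult_nonneg_nonneg[OF zero_le_square]) simp
      ultimately show ?thesis by linarith
    qed
    finally show False by simp
  qed
  have "eigenvalue N (-8)"
    using N_carrier z z_nz Nz unfolding eigenvalue_def eigenvector_def by auto
  then have "{k. eigenvalue N k \<and> k < 0} = {-8}" by (auto dest: unique)
  moreover have "order (-8) (char_poly N) = 1"
    by (rule order_char_poly_eq_1[OF N_carrier N_sym z _ _ Nz simple]) (auto simp: z_index)
  ultimately show ?thesis unfolding one_negative_eigenvalue_def by blast
qed

section \<open>The Strong Arnold Property\<close>

text \<open>Every column of \<open>X\<close> lies in the kernel and so obeys its seven linear
  relations. Together with symmetry and the prescribed zeros these clear the block on 1, ..., 8,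
  which determines all other entries.\<close>

lemma N_strong_Arnold: "strong_Arnold_property 13 N"
  unfolding strong_Arnold_property_def
proof clarify
  fix X assume X: "symmetric_matrix 13 X" "X \<noteq> 0\<^sub>m 13 13" "N * X = 0\<^sub>m 13 13"
    and zero: "\<forall>i<13. \<forall>j<13. i = j \<or> N $$ (i, j) \<noteq> 0 \<longrightarrow> X $$ (i, j) = 0"
  have carr: "X \<in> carrier_mat 13 13" and XT: "transpose_mat X = X"
    using X(1) by (auto simp: symmetric_matrix_def)
  define x where "x i j = X $$ (i, j)" for i j
  have sym: "x i j = x j i" if "i < 13" "j < 13" for i j
    using arg_cong[OF XT, of "\<lambda>Y. Y $$ (i, j)"] carr that by (simp add: x_def)
  have diag: "x i i = 0" if "i < 13" for i using zero that by (simp add: x_def)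
  have edge: "x i j = 0" if "N_rows ! i ! j \<noteq> 0" "i < 13" "j < 13" for i j
    using zero that by (simp add: x_def N_index)
  have "x 0 c = x 2 c + x 3 c + x 4 c + x 5 c \<and>
    x 9 c = x 1 c + x 3 c + 2 * x 6 c \<and>
    x 10 c = x 1 c + x 7 c + 2 * x 4 c \<and>
    x 11 c = x 3 c + x 7 c + 2 * x 8 c \<and>
    2 * x 12 c = x 1 c + x 3 c + x 7 c \<and>
    x 1 c + 2 * x 2 c + x 3 c + x 4 c + x 8 c = 0 \<and>
    x 3 c + x 4 c + 2 * x 5 c + x 6 c + x 7 c = 0" if "c < 13" for c
  proof -
    have "N *\<^sub>v col X c = 0\<^sub>v 13"
      using arg_cong[OF X(3), of "\<lambda>Y. col Y c"] col_mult2[OF N_carrier carr that] that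
      by (simp add: eq_vecI)
    moreover have "col X c \<in> carrier_vec 13" using carr by (rule col_carrier_vec[OF that])
    ultimately show ?thesis using N_kernel_iff[of "col X c"] carr that by (simp add: x_def)
  qed
  note eqs = this
  have h0: "x 0 c = x 2 c + x 3 c + x 4 c + x 5 c"
    and h9: "x 9 c = x 1 c + x 3 c + 2 * x 6 c"
    and h10: "x 10 c = x 1 c + x 7 c + 2 * x 4 c"
    and h11: "x 11 c = x 3 c + x 7 c + 2 * x 8 c"
    and h12: "2 * x 12 c = x 1 c + x 3 c + x 7 c"
    and hA: "x 1 c + 2 * x 2 c + x 3 c + x 4 c + x 8 c = 0"
    and hB: "x 3 c + x 4 c + 2 * x 5 c + x 6 c + x 7 c = 0" if "c < 13" for c
    using eqs[OF that] by blast+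
  have e: "x 0 2 = 0" "x 0 3 = 0" "x 0 4 = 0" "x 0 5 = 0" "x 1 5 = 0" "x 9 1 = 0" "x 10 1 = 0" "x 12 1 = 0"
    "x 2 5 = 0" "x 2 6 = 0" "x 2 7 = 0" "x 9 3 = 0" "x 11 3 = 0" "x 12 3 = 0" "x 4 6 = 0" "x 4 8 = 0"
    "x 10 4 = 0" "x 5 8 = 0" "x 6 8 = 0" "x 9 6 = 0" "x 10 7 = 0" "x 11 7 = 0" "x 12 7 = 0" "x 11 8 = 0"
    by (rule edge; simp add: N_rows_def)+
  have d: "x 1 1 = 0" "x 2 2 = 0" "x 3 3 = 0" "x 4 4 = 0" "x 5 5 = 0" "x 6 6 = 0" "x 7 7 = 0" "x 8 8 = 0"
    by (rule diag; simp)+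
  have s: "x 2 1 = x 1 2" "x 3 1 = x 1 3" "x 4 1 = x 1 4" "x 5 1 = x 1 5" "x 6 1 = x 1 6" "x 7 1 = x 1 7" "x 8 1 = x 1 8"
    "x 3 2 = x 2 3" "x 4 2 = x 2 4" "x 5 2 = x 2 5" "x 6 2 = x 2 6" "x 7 2 = x 2 7" "x 8 2 = x 2 8"
    "x 4 3 = x 3 4" "x 5 3 = x 3 5" "x 6 3 = x 3 6" "x 7 3 = x 3 7" "x 8 3 = x 3 8"
    "x 5 4 = x 4 5" "x 6 4 = x 4 6" "x 7 4 = x 4 7" "x 8 4 = x 4 8"
    "x 6 5 = x 5 6" "x 7 5 = x 5 7" "x 8 5 = x 5 8" "x 7 6 = x 6 7" "x 8 6 = x 6 8" "x 8 7 = x 7 8"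
    by (rule sym; simp)+
  \<comment> \<open>The neighbours of 12 are 1, 3, 7: the three entries between them have pairwise
    sums 0, hence vanish.\<close>
  have c1: "x 1 3 = 0" "x 1 7 = 0" "x 3 7 = 0"
    using h12[of 1] h12[of 3] h12[of 7] by (simp_all add: e d s del: One_nat_def)
  \<comment> \<open>With \<open>c1\<close>, the relations of 9, 10 and 11 in the columns of their
    neighbours are left with one unknown each.\<close>
  have c2: "x 1 6 = 0" "x 1 4 = 0" "x 3 6 = 0" "x 3 8 = 0" "x 4 7 = 0" "x 7 8 = 0"
    using h9[of 1] h10[of 1] h9[of 3] h11[of 3] h10[of 7] h11[of 7] by (simp_all add: e d s c1 del: One_nat_def)
  \<comment> \<open>\<open>h0\<close> in columns 2 to 5 and \<open>hA\<close> in columns 3, 4 clear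
    the pairs among 2, 3, 4, 5. Then \<open>hA\<close> clears the triangle {1, 2, 8} and
    \<open>hB\<close> the triangle {5, 6, 7}.\<close>
  have c3: "x 1 2 = 0" "x 1 8 = 0" "x 2 8 = 0" "x 2 3 = 0" "x 2 4 = 0" "x 3 4 = 0"
    "x 3 5 = 0" "x 4 5 = 0" "x 5 6 = 0" "x 5 7 = 0" "x 6 7 = 0"
    using hA[of 1] hA[of 2] hA[of 3] hA[of 4] hA[of 8] h0[of 2] h0[of 3] h0[of 4] h0[of 5]
      hB[of 3] hB[of 4] hB[of 5] hB[of 6] hB[of 7] by (simp_all add: e d s c1 c2 del: One_nat_def)
  have core: "x i j = 0" if "i \<in> {1, 2, 3, 4, 5, 6, 7, 8}" "j \<in> {1, 2, 3, 4, 5, 6, 7, 8}" for i j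
    using that by (elim insertE emptyE) (simp_all add: e d s c1 c2 c3 del: One_nat_def)
  \<comment> \<open>Used twice: first for the columns 1, ..., 8, then, by symmetry of
    \<open>X\<close>, for every column.\<close>
  have extend: "x i c = 0" if "c < 13" "i < 13" "\<And>j. j \<in> {1, 2, 3, 4, 5, 6, 7, 8} \<Longrightarrow> x j c = 0" for i c
  proof -
    have y: "x 1 c = 0" "x 2 c = 0" "x 3 c = 0" "x 4 c = 0" "x 5 c = 0" "x 6 c = 0" "x 7 c = 0" "x 8 c = 0"
      by (rule that(3); simp)+
    have "x 0 c = 0" "x 9 c = 0" "x 10 c = 0" "x 11 c = 0" "x 12 c = 0"
      using h0[OF \<open>c < 13\<close>] h9[OF \<open>c < 13\<close>] h10[OF \<open>c < 13\<close>] h11[OF \<open>c < 13\<close>] h12[OF \<open>c < 13\<close>]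
      by (simp_all add: y del: One_nat_def)
    with y show ?thesis using \<open>i < 13\<close> unfolding less_13_cases by (elim insertE emptyE; hypsubst)
  qed
  have half: "x i j = 0" if "i < 13" "j \<in> {1, 2, 3, 4, 5, 6, 7, 8}" for i j
  proof (rule extend)
    show "j < 13" using that(2) by auto
  qed (use that core in blast)+
  have all: "x i j = 0" if "i < 13" "j < 13" for i j
  proof (rule extend[OF that(2,1)])
    fix k :: nat assume k: "k \<in> {1, 2, 3, 4, 5, 6, 7, 8}"
    then have "k < 13" by auto
    moreover have "x j k = 0" by (rule half[OF \<open>j < 13\<close> k])
    ultimately show "x k j = 0" using sym[of k j] \<open>j < 13\<close> by simp
  qed
  have "X = 0\<^sub>m 13 13"
    using all carr by (intro eq_matI) (auto simp: x_def)
  with X(2) show False by simp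
qed

section \<open>Corank of the matrix and value of the invariant\<close>

lemma kernel_dim_N: "6 \<le> kernel_dim N"
proof -
  note [simp del] = index_mult_mat_vec
  \<comment> \<open>The coordinates 2, 3, 4, 5, 6, 8 are free and set to a unit vector
    \<open>e\<close>; A = 0 is solved for \<open>x1\<close>, B = 0 for \<open>x7\<close>, and the
    other relations for 0 and 9 to 12.\<close>
  define f where "f j =
    (let e = (\<lambda>i. if i = j then 1 else 0 :: real);
         x1 = - (2 * e 2 + e 3 + e 4 + e 8);
         x7 = - (e 3 + e 4 + 2 * e 5 + e 6)
     in vec 13 ((!) [e 2 + e 3 + e 4 + e 5, x1, e 2, e 3, e 4, e 5, e 6, x7, e 8,
          x1 + e 3 + 2 * e 6, x1 + x7 + 2 * e 4, e 3 + x7 + 2 * e 8, (x1 + e 3 + x7) / 2]))"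
    for j :: nat
  have f: "f j \<in> carrier_vec 13" for j by (simp add: f_def Let_def)
  have "card {2, 3, 4, 5, 6, 8 :: nat} \<le> kernel_dim N"
  proof (rule card_le_kernel_dim[OF N_carrier])
    fix j :: nat
    show "f j \<in> mat_kernel N"
    proof (rule mat_kernelI[OF N_carrier f], subst N_kernel_iff[OF f])
      show "f j $ 0 = f j $ 2 + f j $ 3 + f j $ 4 + f j $ 5 \<and>
        f j $ 9 = f j $ 1 + f j $ 3 + 2 * f j $ 6 \<and>
        f j $ 10 = f j $ 1 + f j $ 7 + 2 * f j $ 4 \<and>
        f j $ 11 = f j $ 3 + f j $ 7 + 2 * f j $ 8 \<and>
        2 * f j $ 12 = f j $ 1 + f j $ 3 + f j $ 7 \<and>
        f j $ 1 + 2 * f j $ 2 + f j $ 3 + f j $ 4 + f j $ 8 = 0 \<and>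
        f j $ 3 + f j $ 4 + 2 * f j $ 5 + f j $ 6 + f j $ 7 = 0"
        unfolding f_def Let_def by simp
    qed
  next
    fix i j :: nat assume "i \<in> {2, 3, 4, 5, 6, 8}"
    then show "f j $ i = (if i = j then 1 else 0)"
      unfolding f_def Let_def by (elim insertE emptyE) simp_all
  qed auto
  then show ?thesis by simp
qed

theorem mainTheorem1:
  shows "colin_de_verdiere 13 G_13_24 = 6"
proof -
  have "N \<in> CdV_matrices 13 G_13_24"
    using N_carrier N_sym N_pattern N_one_negative N_strong_Arnold
    by (simp add: CdV_matrices_def symmetric_matrix_def)
  moreover have upper: "kernel_dim M \<le> 6" if "M \<in> CdV_matrices 13 G_13_24" for M
    using that kernel_dim_le_6 by (simp add: CdV_matrices_def symmetric_matrix_def)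
  ultimately have "kernel_dim N = 6" using kernel_dim_N by (simp add: le_antisym)
  show ?thesis unfolding colin_de_verdiere_def
  proof (rule Max_eqI[OF finite_CdV_coranks])
    show "6 \<in> kernel_dim ` CdV_matrices 13 G_13_24"
      using \<open>N \<in> CdV_matrices 13 G_13_24\<close> \<open>kernel_dim N = 6\<close> by force
  qed (use upper in auto)
qed

end
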